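(* Let $0\le a<b<\infty$, $\Delta=[a,b]$, and let $\Phi\in C^1(\Delta,\mathbb R)$ be increasing with $\Phi'(\ell)\neq 0$ for all $\ell\in\Delta$. For a given $\mathbb H\in C(\Delta,\mathbb R)$, $0<\kappa<\mu\le 1$, $\omega>0$ and $\mathfrak z_a\in\mathbb R$, the linear fractional initial value problem $$ {}^c\mathbb D_{a^+}^{\mu;\Phi}\mathfrak z(\ell)+\omega\,{}^c\mathbb D_{a^+}^{\kappa;\Phi}\mathfrak z(\ell)=\mathbb H(\ell),\quad \ell\in\Delta,\qquad \mathfrak z(a)=\mathfrak z_a, $$ has a unique solution, given explicitly by $$ \mathfrak z(\ell)=\mathfrak z_a+\int_a^{\ell}\Phi'(\rho)\,(\Phi(\ell)-\Phi(\rho))^{\mu-1}\,\mathbb E_{\mu-\kappa,\mu}\bigl(-\omega(\Phi(\ell)-\Phi(\rho))^{\mu-\kappa}\bigr)\,\mathbb H(\rho)\,\mathrm d\rho. $$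
   Context: For $\alpha>0$ and an integrable function $\mathfrak z:\Delta\to\mathbb R$, the Riemann–Liouville fractional integral of order $\alpha$ with respect to $\Phi$ is $\mathbb I_{a^+}^{\alpha;\Phi}\mathfrak z(\ell)=\int_a^\ell\frac{\Phi'(\rho)(\Phi(\ell)-\Phi(\rho))^{\alpha-1}}{\Gamma(\alpha)}\,\mathfrak z(\rho)\,\mathrm d\rho$, where $\Gamma$ is the Gamma function. For $\Phi,\mathfrak z\in C^n(\Delta,\mathbb R)$, the Caputo fractional derivative of $\mathfrak z$ of order $\alpha>0$ with respect to $\Phi$ is ${}^c\mathbb D_{a^+}^{\alpha;\Phi}\mathfrak z(\ell)=\mathbb I_{a^+}^{n-\alpha;\Phi}\mathfrak z_\Phi^{[n]}(\ell)$ if $\alpha\notin\mathbb N$, with $n=[\alpha]+1$, and ${}^c\mathbb D_{a^+}^{\alpha;\Phi}\mathfrak z(\ell)=\mathfrak z_\Phi^{[n]}(\ell)$ if $\alpha=n\in\mathbb N$, where $\mathfrak z_\Phi^{[n]}(\ell)=\left(\frac{1}{\Phi'(\ell)}\frac{\mathrm d}{\mathrm d\ell}\right)^n\mathfrak z(\ell)$. For the orders $\kappa,\mu\in(0,1]$ used here, $n=1$. The two-parameter Mittag-Leffler function is $\mathbb E_{p,q}(x)=\sum_{k=0}^\infty \frac{x^k}{\Gamma(pk+q)}$ for $p,q>0$, $x\in\mathbb R$.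
   Formalization: For μ<1 a C¹ solution forces H(a)=0, so existence fails e.g. for H=1. Existence and uniqueness are proved with the Caputo derivative extended to (1/Φ')d/dℓ I^{1-α}(z−z(a)) for continuous z; in the C¹ sense, z is a solution iff z is C¹ and given by the formula. *)

theory Defs
  imports "HOL-Analysis.Analysis"
begin

text \<open>
  All derivatives on \<open>[a, b]\<close> are taken within \<open>[a, b]\<close>, hence one-sided at the endpoints;
  values of the functions outside \<open>[a, b]\<close> play no role.
\<close>

definition C1_on :: "real \<Rightarrow> real \<Rightarrow> (real \<Rightarrow> real) \<Rightarrow> bool" where
  "C1_on a b f \<longleftrightarrow> f differentiable_on {a..b} \<and>
     continuous_on {a..b} (\<lambda>x. vector_derivative f (at x within {a..b}))"

definition phi_deriv :: "real \<Rightarrow> real \<Rightarrow> (real \<Rightarrow> real) \<Rightarrow> (real \<Rightarrow> real) \<Rightarrow> real \<Rightarrow> real" where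
  "phi_deriv a b \<Phi> z l =
     1 / vector_derivative \<Phi> (at l within {a..b}) * vector_derivative z (at l within {a..b})"

definition rl_integral ::
    "real \<Rightarrow> real \<Rightarrow> (real \<Rightarrow> real) \<Rightarrow> real \<Rightarrow> (real \<Rightarrow> real) \<Rightarrow> real \<Rightarrow> real" where
  "rl_integral a b \<Phi> \<alpha> z l =
     integral {a..l} (\<lambda>\<rho>. vector_derivative \<Phi> (at \<rho> within {a..b}) *
       (\<Phi> l - \<Phi> \<rho>) powr (\<alpha> - 1) / Gamma \<alpha> * z \<rho>)"

definition caputo ::
    "real \<Rightarrow> real \<Rightarrow> (real \<Rightarrow> real) \<Rightarrow> real \<Rightarrow> (real \<Rightarrow> real) \<Rightarrow> real \<Rightarrow> real" where
  "caputo a b \<Phi> \<alpha> z =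
     (if \<alpha> \<in> \<nat> then (phi_deriv a b \<Phi> ^^ nat \<lfloor>\<alpha>\<rfloor>) z
      else rl_integral a b \<Phi> (of_int (\<lfloor>\<alpha>\<rfloor> + 1) - \<alpha>)
             ((phi_deriv a b \<Phi> ^^ nat (\<lfloor>\<alpha>\<rfloor> + 1)) z))"

definition mittag_leffler :: "real \<Rightarrow> real \<Rightarrow> real \<Rightarrow> real" where
  "mittag_leffler p q x = (\<Sum>k. x ^ k / Gamma (p * real k + q))"

definition C1_solution ::
    "real \<Rightarrow> real \<Rightarrow> (real \<Rightarrow> real) \<Rightarrow> real \<Rightarrow> real \<Rightarrow> real \<Rightarrow> (real \<Rightarrow> real) \<Rightarrow> real \<Rightarrow>
     (real \<Rightarrow> real) \<Rightarrow> bool" where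
  "C1_solution a b \<Phi> \<mu> \<kappa> \<omega> H za z \<longleftrightarrow>
     C1_on a b z \<and>
     (\<forall>l\<in>{a..b}. caputo a b \<Phi> \<mu> z l + \<omega> * caputo a b \<Phi> \<kappa> z l = H l) \<and>
     z a = za"

text \<open>
  For \<open>\<mu> < 1\<close> the Caputo derivative of a \<open>C\<^sup>1\<close> function vanishes at \<open>a\<close>, so the initial value
  problem has no \<open>C\<^sup>1\<close> solution unless \<open>H a = 0\<close>:
\<close>

lemma C1_solution_imp_zero:
  assumes "C1_solution a b \<Phi> \<mu> \<kappa> \<omega> H za z" and "a < b" and "0 < \<kappa>" "\<kappa> < \<mu>" "\<mu> < 1"
  shows "H a = 0"
proof -
  have "caputo a b \<Phi> \<alpha> z a = 0" if "0 < \<alpha>" "\<alpha> < 1" for \<alpha>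
  proof -
    have "\<alpha> \<notin> \<nat>"
      using that by (auto elim!: Nats_cases)
    then show ?thesis
      by (simp add: caputo_def rl_integral_def)
  qed
  then have "caputo a b \<Phi> \<mu> z a = 0" and "caputo a b \<Phi> \<kappa> z a = 0"
    using assms by auto
  moreover have "caputo a b \<Phi> \<mu> z a + \<omega> * caputo a b \<Phi> \<kappa> z a = H a"
    using assms unfolding C1_solution_def by (meson atLeastAtMost_iff less_imp_le order_refl)
  ultimately show ?thesis
    by simp
qed

text \<open>
  For merely continuous right-hand sides the Caputo derivative is therefore understood in its
  usual extended sense, as the Riemann--Liouville derivative of \<open>z - z(a)\<close>: for \<open>0 < \<alpha> \<le> 1\<close>,
  it is \<open>(1/\<Phi>') d/dl I\<^sup>1\<^sup>-\<^sup>\<alpha>(z - z(a))\<close>, with \<open>I\<^sup>0\<close> the identity,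
  defined for continuous \<open>z\<close> for which \<open>I\<^sup>1\<^sup>-\<^sup>\<alpha>(z - z(a))\<close> is \<open>C\<^sup>1\<close>.  On \<open>C\<^sup>1\<close> functions it
  agrees with \<open>caputo\<close>, and for \<open>\<alpha> = 1\<close> its domain is exactly \<open>C\<^sup>1\<close>.  The case distinction is
  needed because \<open>rl_integral\<close> at order \<open>0\<close> is \<open>0\<close>, not the identity.
\<close>

definition caputo_primitive ::
    "real \<Rightarrow> real \<Rightarrow> (real \<Rightarrow> real) \<Rightarrow> real \<Rightarrow> (real \<Rightarrow> real) \<Rightarrow> real \<Rightarrow> real" where
  "caputo_primitive a b \<Phi> \<alpha> z =
     (if \<alpha> = 1 then (\<lambda>\<rho>. z \<rho> - z a)
      else rl_integral a b \<Phi> (1 - \<alpha>) (\<lambda>\<rho>. z \<rho> - z a))"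

definition caputo_ext_dom ::
    "real \<Rightarrow> real \<Rightarrow> (real \<Rightarrow> real) \<Rightarrow> real \<Rightarrow> (real \<Rightarrow> real) \<Rightarrow> bool" where
  "caputo_ext_dom a b \<Phi> \<alpha> z \<longleftrightarrow>
     continuous_on {a..b} z \<and> C1_on a b (caputo_primitive a b \<Phi> \<alpha> z)"

definition caputo_ext ::
    "real \<Rightarrow> real \<Rightarrow> (real \<Rightarrow> real) \<Rightarrow> real \<Rightarrow> (real \<Rightarrow> real) \<Rightarrow> real \<Rightarrow> real" where
  "caputo_ext a b \<Phi> \<alpha> z = phi_deriv a b \<Phi> (caputo_primitive a b \<Phi> \<alpha> z)"

definition ext_solution ::
    "real \<Rightarrow> real \<Rightarrow> (real \<Rightarrow> real) \<Rightarrow> real \<Rightarrow> real \<Rightarrow> real \<Rightarrow> (real \<Rightarrow> real) \<Rightarrow> real \<Rightarrow>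
     (real \<Rightarrow> real) \<Rightarrow> bool" where
  "ext_solution a b \<Phi> \<mu> \<kappa> \<omega> H za z \<longleftrightarrow>
     caputo_ext_dom a b \<Phi> \<mu> z \<and> caputo_ext_dom a b \<Phi> \<kappa> z \<and>
     (\<forall>l\<in>{a..b}. caputo_ext a b \<Phi> \<mu> z l + \<omega> * caputo_ext a b \<Phi> \<kappa> z l = H l) \<and>
     z a = za"

definition solution_formula ::
    "real \<Rightarrow> real \<Rightarrow> (real \<Rightarrow> real) \<Rightarrow> real \<Rightarrow> real \<Rightarrow> real \<Rightarrow> (real \<Rightarrow> real) \<Rightarrow> real \<Rightarrow>
     real \<Rightarrow> real" where
  "solution_formula a b \<Phi> \<mu> \<kappa> \<omega> H za l =
     za + integral {a..l} (\<lambda>\<rho>. vector_derivative \<Phi> (at \<rho> within {a..b}) *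
       (\<Phi> l - \<Phi> \<rho>) powr (\<mu> - 1) *
       mittag_leffler (\<mu> - \<kappa>) \<mu> (- \<omega> * (\<Phi> l - \<Phi> \<rho>) powr (\<mu> - \<kappa>)) * H \<rho>)"

end

theory Submission
  imports Defs "HOL-Real_Asymp.Real_Asymp"
begin

text \<open>
  Measure time by \<open>\<Phi> l - \<Phi> a\<close> instead of \<open>l\<close>.  The weighted fractional integrals become the classical
  ones on an interval \<open>{0..T}\<close>, written \<open>J\<^sup>\<alpha>\<close> here and \<open>frac_int \<alpha>\<close> below, with \<open>J\<^sup>0\<close> the identity.  For
  \<open>y = z - z(a)\<close> the equation says that \<open>J\<^sup>1\<^sup>-\<^sup>\<mu> y = J\<^sup>1 p\<close> and \<open>J\<^sup>1\<^sup>-\<^sup>\<kappa> y = J\<^sup>1 q\<close> for continuous \<open>p\<close>, \<open>q\<close>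
  with \<open>p + \<omega> q = h\<close>, where \<open>h\<close> is the right-hand side in the new time.

  The semigroup law \<open>J\<^sup>\<alpha> J\<^sup>\<beta> = J\<^sup>\<alpha>\<^sup>+\<^sup>\<beta>\<close> (\<open>frac_int_semigroup\<close>) and the injectivity of \<open>J\<^sup>\<alpha>\<close>
  (\<open>frac_int_eqD\<close>) turn this into \<open>y = J\<^sup>\<mu> p\<close>, \<open>q = J\<^sup>\<beta> p\<close> with \<open>\<beta> = \<mu> - \<kappa>\<close>, so that the whole problem is
  \<open>p + \<omega> J\<^sup>\<beta> p = h\<close>.  The unique continuous solution of that equation is the Neumann series
  \<open>\<Sum>k. (-\<omega>)\<^sup>k J\<^sup>k\<^sup>\<beta> h\<close> (\<open>neumann_series_equation\<close>, \<open>neumann_series_unique\<close>): the norm of its \<open>k\<close>-th term is at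
  most a constant times \<open>(\<omega> T\<^sup>\<beta>)\<^sup>k / \<Gamma>(k\<beta> + 1)\<close>, a term of a convergent Mittag-Leffler series.  Applying
  \<open>J\<^sup>\<mu>\<close> termwise gives \<open>y = \<Sum>k. (-\<omega>)\<^sup>k J\<^sup>\<mu>\<^sup>+\<^sup>k\<^sup>\<beta> h\<close>, and summing the kernels
  \<open>t\<^sup>\<mu>\<^sup>+\<^sup>k\<^sup>\<beta>\<^sup>-\<^sup>1 / \<Gamma>(\<mu> + k\<beta>)\<close> of these integrals yields the Mittag-Leffler kernel of the solution formula
  (\<open>frac_int_mittag_leffler\<close>).

  A \<open>C\<^sup>1\<close> function has the same Caputo derivative in the classical and in the extended sense
  (\<open>caputo_ext_C1\<close>), so the \<open>C\<^sup>1\<close> solutions are the extended solutions that are \<open>C\<^sup>1\<close>.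
\<close>

section \<open>Convergence of the Mittag-Leffler series\<close>

text \<open>
  Log-convexity of \<open>Gamma\<close> between \<open>x + p\<close> and \<open>x + p + 1\<close> bounds \<open>Gamma (x + 1) = x * Gamma x\<close>.
  The resulting bound on the quotient tends to \<open>0\<close> as \<open>x\<close> grows, so the ratio test applies to the
  Mittag-Leffler series for every argument.
\<close>

lemma Gamma_quotient_le:
  fixes x p :: real
  assumes "0 < x" "0 < p" "p \<le> 1"
  shows "Gamma x / Gamma (x + p) \<le> (x + p) powr (1 - p) / x"
proof -
  have pos: "Gamma x > 0" "Gamma (x + p) > 0" "Gamma (x + 1) > 0" "Gamma (x + p + 1) > 0"
    using assms by auto
  have shift: "Gamma (x + 1) = x * Gamma x" "Gamma (x + p + 1) = (x + p) * Gamma (x + p)"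
    using assms by (intro Gamma_plus1; force elim!: nonpos_Ints_cases)+
  have "ln (Gamma (x + 1)) \<le> p * ln (Gamma (x + p)) + (1 - p) * ln (Gamma (x + p + 1))"
    using convex_onD[OF log_convex_Gamma_real, of "1 - p" "x + p" "x + p + 1"] assms
    by (simp add: algebra_simps)
  also have "\<dots> = ln (Gamma (x + p) * (x + p) powr (1 - p))"
    unfolding shift using pos assms by (simp add: ln_mult ln_powr) (simp add: algebra_simps)
  finally have "Gamma (x + 1) \<le> Gamma (x + p) * (x + p) powr (1 - p)"
    using pos assms by (subst (asm) ln_le_cancel_iff) auto
  then show ?thesis
    using pos assms unfolding shift by (simp add: field_simps)
qed

lemma summable_mittag_leffler:
  fixes p q x :: real
  assumes "0 < p" "p \<le> 1" "0 < q"
  shows "summable (\<lambda>k. x ^ k / Gamma (p * real k + q))"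
proof -
  have "(\<lambda>k. \<bar>x\<bar> * ((p * real k + q + p) powr (1 - p) / (p * real k + q))) \<longlonglongrightarrow> 0"
    using assms by real_asymp
  then have "\<forall>\<^sub>F k in sequentially.
      \<bar>x\<bar> * ((p * real k + q + p) powr (1 - p) / (p * real k + q)) < 1 / 2"
    by (rule order_tendstoD) simp
  then obtain N where N: "\<And>k. k \<ge> N \<Longrightarrow>
      \<bar>x\<bar> * ((p * real k + q + p) powr (1 - p) / (p * real k + q)) < 1 / 2"
    by (auto simp: eventually_sequentially)
  show ?thesis
  proof (rule summable_ratio_test)
    show "(1 / 2 :: real) < 1" by simp
    fix k assume "N \<le> k"
    define y where "y = p * real k + q"
    have y: "y > 0" using assms by (simp add: y_def add_nonneg_pos)
    have pos: "Gamma y > 0" "Gamma (y + p) > 0"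
      using y assms by auto
    have "\<bar>x\<bar> * (Gamma y / Gamma (y + p)) \<le> \<bar>x\<bar> * ((y + p) powr (1 - p) / y)"
      using Gamma_quotient_le[of y p] y assms by (intro mult_left_mono) auto
    also have "\<dots> \<le> 1 / 2"
      using N[OF \<open>N \<le> k\<close>] by (simp add: y_def)
    finally have "\<bar>x\<bar> / Gamma (y + p) \<le> 1 / 2 * (1 / Gamma y)"
      using pos by (simp add: field_simps)
    then have "\<bar>x\<bar> / Gamma (y + p) * \<bar>x\<bar> ^ k \<le> 1 / 2 * (1 / Gamma y) * \<bar>x\<bar> ^ k"
      by (rule mult_right_mono) simp
    moreover have "p * real (Suc k) + q = y + p"
      by (simp add: y_def algebra_simps)
    ultimately show "norm (x ^ Suc k / Gamma (p * real (Suc k) + q))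
        \<le> 1 / 2 * norm (x ^ k / Gamma (p * real k + q))"
      using pos by (simp add: norm_mult norm_power abs_mult power_abs y_def[symmetric] mult_ac)
  qed
qed

section \<open>Fractional integrals as bounded operators on continuous functions\<close>

text \<open>
  The Riemann--Liouville integral for the identity time scale.  Setting order \<open>0\<close> to the identity
  (the integral itself would be \<open>0\<close>, since \<open>Gamma 0 = 0\<close>) makes the semigroup law hold for all
  nonnegative orders; this treats \<open>\<mu> = 1\<close> together with \<open>\<mu> < 1\<close> and supplies the leading term of
  the Neumann series.
\<close>

definition frac_int :: "real \<Rightarrow> (real \<Rightarrow> real) \<Rightarrow> real \<Rightarrow> real" where
  "frac_int \<alpha> f t =
     (if \<alpha> = 0 then f t else integral {0..t} (\<lambda>s. (t - s) powr (\<alpha> - 1) / Gamma \<alpha> * f s))"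

lemma frac_int_0 [simp]: "frac_int 0 f t = f t"
  by (simp add: frac_int_def)

lemma frac_int_at_0: "0 < \<alpha> \<Longrightarrow> frac_int \<alpha> f 0 = 0"
  by (simp add: frac_int_def)

lemma frac_int_cong:
  assumes "\<And>s. s \<in> {0..t} \<Longrightarrow> f s = g s" "0 \<le> t"
  shows "frac_int \<alpha> f t = frac_int \<alpha> g t"
  using assms by (auto simp: frac_int_def intro!: integral_cong)

lemma frac_int_1:
  "frac_int 1 f t = integral {0..t} f"
proof -
  have "integral {0..t} (\<lambda>s. (t - s) powr 0 * f s) = integral {0..t} f"
    by (rule integral_spike[of "{t}"]) auto
  then show ?thesis by (simp add: frac_int_def)
qed

text \<open>
  The Beta integral, stretched from \<open>{0..1}\<close> to \<open>{0..t}\<close>.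
\<close>

lemma has_integral_kernel_powr:
  fixes t \<alpha> \<gamma> :: real
  assumes "0 < \<alpha>" "-1 < \<gamma>" "0 \<le> t"
  shows "((\<lambda>s. (t - s) powr (\<alpha> - 1) / Gamma \<alpha> * s powr \<gamma>) has_integral
           Gamma (\<gamma> + 1) / Gamma (\<gamma> + 1 + \<alpha>) * t powr (\<gamma> + \<alpha>)) {0..t}"
proof (cases "t = 0")
  case True
  then show ?thesis using has_integral_refl(2)[of _ "0 :: real"] assms by simp
next
  case False
  with assms have t: "t > 0" by simp
  have pos: "Gamma \<alpha> > 0" "Gamma (\<gamma> + 1) > 0" "Gamma (\<gamma> + 1 + \<alpha>) > 0"
    using assms by auto
  have "((\<lambda>u. u powr \<gamma> * (1 - u) powr (\<alpha> - 1)) has_integral Beta (\<gamma> + 1) \<alpha>) (cbox 0 1)"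
    using has_integral_Beta_real[of "\<gamma> + 1" \<alpha>] assms by simp
  then have "((\<lambda>s. (s / t) powr \<gamma> * (1 - s / t) powr (\<alpha> - 1)) has_integral t * Beta (\<gamma> + 1) \<alpha>) {0..t}"
    using has_integral_affinity'[of "\<lambda>u. u powr \<gamma> * (1 - u) powr (\<alpha> - 1)" "Beta (\<gamma> + 1) \<alpha>" "0 :: real" 1 "1 / t" 0] t
    by (simp add: mult.commute)
  then have "((\<lambda>s. t powr (\<alpha> - 1 + \<gamma>) / Gamma \<alpha> * ((s / t) powr \<gamma> * (1 - s / t) powr (\<alpha> - 1)))
      has_integral (t powr (\<alpha> - 1 + \<gamma>) / Gamma \<alpha> * (t * Beta (\<gamma> + 1) \<alpha>))) {0..t}"
    by (rule has_integral_mult_right)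
  then have "((\<lambda>s. (t - s) powr (\<alpha> - 1) / Gamma \<alpha> * s powr \<gamma>) has_integral
      (t powr (\<alpha> - 1 + \<gamma>) / Gamma \<alpha> * (t * Beta (\<gamma> + 1) \<alpha>))) {0..t}"
  proof (rule has_integral_eq[rotated])
    fix s assume "s \<in> {0..t}"
    moreover have "1 - s / t = (t - s) / t"
      using t by (simp add: field_simps)
    moreover have "t powr (\<alpha> - 1 + \<gamma>) = t powr (\<alpha> - 1) * t powr \<gamma>"
      by (rule powr_add)
    ultimately show "t powr (\<alpha> - 1 + \<gamma>) / Gamma \<alpha> * ((s / t) powr \<gamma> * (1 - s / t) powr (\<alpha> - 1))
        = (t - s) powr (\<alpha> - 1) / Gamma \<alpha> * s powr \<gamma>"
      using t by (simp add: powr_divide)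
  qed
  moreover have "t powr (\<alpha> - 1 + \<gamma>) / Gamma \<alpha> * (t * Beta (\<gamma> + 1) \<alpha>)
      = Gamma (\<gamma> + 1) / Gamma (\<gamma> + 1 + \<alpha>) * t powr (\<gamma> + \<alpha>)"
  proof -
    have "t powr (\<gamma> + \<alpha>) = t powr (\<alpha> - 1 + \<gamma>) * t"
      using t powr_add[of t "\<alpha> - 1 + \<gamma>" 1] by (simp add: algebra_simps)
    then show ?thesis using pos by (simp add: Beta_def)
  qed
  ultimately show ?thesis by simp
qed

text \<open>
  A separate statement because \<open>0 powr 0 = 0\<close>: the function \<open>\<lambda>s. s powr 0\<close> is not the constant \<open>1\<close>.
\<close>

lemma has_integral_kernel:
  fixes t \<alpha> :: real
  assumes "0 < \<alpha>" "0 \<le> t"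
  shows "((\<lambda>s. (t - s) powr (\<alpha> - 1) / Gamma \<alpha>) has_integral t powr \<alpha> / Gamma (\<alpha> + 1)) {0..t}"
proof (rule has_integral_spike_finite[where S = "{0}"])
  show "((\<lambda>s. (t - s) powr (\<alpha> - 1) / Gamma \<alpha> * s powr 0) has_integral
           t powr \<alpha> / Gamma (\<alpha> + 1)) {0..t}"
    using has_integral_kernel_powr[of \<alpha> 0 t] assms by (simp add: add.commute)
qed auto

lemma kernel_times_absolutely_integrable:
  fixes f :: "real \<Rightarrow> real"
  assumes "0 < \<alpha>" "continuous_on {0..t} f"
  shows "(\<lambda>s. (t - s) powr (\<alpha> - 1) / Gamma \<alpha> * f s) absolutely_integrable_on {0..t}"
proof (cases "0 \<le> t")
  case True
  have "(\<lambda>s. f s * ((t - s) powr (\<alpha> - 1) / Gamma \<alpha>)) absolutely_integrable_on {0..t}"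
  proof (rule absolutely_integrable_bounded_measurable_product_real)
    show "(\<lambda>s. (t - s) powr (\<alpha> - 1) / Gamma \<alpha>) absolutely_integrable_on {0..t}"
      using has_integral_kernel[OF assms(1) True] assms(1)
      by (intro nonnegative_absolutely_integrable_1) (auto simp: has_integral_iff)
    show "bounded (f ` {0..t})"
      using assms(2) compact_continuous_image compact_imp_bounded by blast
    show "f \<in> borel_measurable (lebesgue_on {0..t})"
      using assms(2) by (intro continuous_imp_measurable_on_sets_lebesgue) auto
  qed auto
  then show ?thesis by (simp add: mult.commute)
qed simp

lemma kernel_times_integrable:
  fixes f :: "real \<Rightarrow> real"
  assumes "0 < \<alpha>" "continuous_on {0..t} f"
  shows "(\<lambda>s. (t - s) powr (\<alpha> - 1) / Gamma \<alpha> * f s) integrable_on {0..t}"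
  using kernel_times_absolutely_integrable[OF assms] set_lebesgue_integral_eq_integral(1) by blast

lemma frac_int_add:
  assumes "0 \<le> \<alpha>" "continuous_on {0..t} f" "continuous_on {0..t} g"
  shows "frac_int \<alpha> (\<lambda>s. f s + g s) t = frac_int \<alpha> f t + frac_int \<alpha> g t"
  using assms kernel_times_integrable[of \<alpha> t]
  by (auto simp: frac_int_def ring_distribs integral_add)

lemma frac_int_cmult:
  "frac_int \<alpha> (\<lambda>s. c * f s) t = c * frac_int \<alpha> f t"
  by (simp add: frac_int_def mult.left_commute flip: integral_mult_right)

lemma frac_int_diff:
  assumes "0 \<le> \<alpha>" "continuous_on {0..t} f" "continuous_on {0..t} g"
  shows "frac_int \<alpha> (\<lambda>s. f s - g s) t = frac_int \<alpha> f t - frac_int \<alpha> g t"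
  using frac_int_add[of \<alpha> t f "\<lambda>s. -1 * g s"] assms unfolding frac_int_cmult
  by (simp add: continuous_on_minus)

lemma frac_int_sum:
  assumes "0 \<le> \<alpha>" "finite I" "\<And>i. i \<in> I \<Longrightarrow> continuous_on {0..t} (f i)"
  shows "frac_int \<alpha> (\<lambda>s. \<Sum>i\<in>I. f i s) t = (\<Sum>i\<in>I. frac_int \<alpha> (f i) t)"
  using assms(2,3)
proof (induction I rule: finite_induct)
  case empty
  then show ?case by (simp add: frac_int_def)
next
  case (insert i I)
  then show ?case
    using assms(1) by (simp add: frac_int_add continuous_on_sum)
qed

text \<open>
  The estimate behind every limit argument below.  It is uniform in \<open>t\<close>; stated with \<open>t powr \<alpha>\<close>
  instead of \<open>T powr \<alpha>\<close> it would fail for \<open>\<alpha> = 0\<close>, \<open>t = 0\<close>.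
\<close>

lemma frac_int_bound:
  assumes "0 \<le> \<alpha>" "continuous_on {0..T} f" "\<And>s. s \<in> {0..T} \<Longrightarrow> \<bar>f s\<bar> \<le> M"
    and "t \<in> {0..T}" "0 < T"
  shows "\<bar>frac_int \<alpha> f t\<bar> \<le> M * (T powr \<alpha> / Gamma (\<alpha> + 1))"
proof (cases "\<alpha> = 0")
  case True
  then show ?thesis using assms by simp
next
  case False
  with assms have \<alpha>: "\<alpha> > 0" by simp
  have M: "0 \<le> M" using assms(3)[of 0] assms(5) by simp
  have cont: "continuous_on {0..t} f"
    using assms continuous_on_subset by fastforce
  have "norm (integral {0..t} (\<lambda>s. (t - s) powr (\<alpha> - 1) / Gamma \<alpha> * f s))
      \<le> integral {0..t} (\<lambda>s. (t - s) powr (\<alpha> - 1) / Gamma \<alpha> * M)"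
  proof (rule integral_norm_bound_integral)
    show "norm ((t - s) powr (\<alpha> - 1) / Gamma \<alpha> * f s) \<le> (t - s) powr (\<alpha> - 1) / Gamma \<alpha> * M"
      if "s \<in> {0..t}" for s
      using assms(3)[of s] assms(4) that \<alpha> by (auto simp: abs_mult intro!: mult_left_mono divide_right_mono)
  qed (use kernel_times_integrable[OF \<alpha>] cont in auto)
  also have "\<dots> = t powr \<alpha> / Gamma (\<alpha> + 1) * M"
    using has_integral_mult_left[OF has_integral_kernel[OF \<alpha>, of t], of M] assms(4)
    by (auto dest: integral_unique)
  also have "\<dots> \<le> T powr \<alpha> / Gamma (\<alpha> + 1) * M"
    using M assms(4) \<alpha> by (intro mult_right_mono divide_right_mono powr_mono2) auto
  finally show ?thesis using False by (simp add: frac_int_def mult.commute)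
qed

lemma uniform_limit_frac_int:
  assumes "0 \<le> \<alpha>" "0 < T" "\<And>n. continuous_on {0..T} (f n)" "uniform_limit {0..T} f g sequentially"
  shows "uniform_limit {0..T} (\<lambda>n. frac_int \<alpha> (f n)) (frac_int \<alpha> g) sequentially"
proof (rule uniform_limitI)
  fix e :: real assume "e > 0"
  define C where "C = T powr \<alpha> / Gamma (\<alpha> + 1)"
  have C: "C > 0" using assms(1,2) by (simp add: C_def)
  have g: "continuous_on {0..T} g"
    using assms(3,4) by (intro uniform_limit_theorem[where f = f and F = sequentially]) auto
  have "\<forall>\<^sub>F n in sequentially. \<forall>s\<in>{0..T}. dist (f n s) (g s) < e / (2 * C)"
    using assms(4) \<open>e > 0\<close> C by (intro uniform_limitD) auto
  then show "\<forall>\<^sub>F n in sequentially. \<forall>t\<in>{0..T}. dist (frac_int \<alpha> (f n) t) (frac_int \<alpha> g t) < e"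
  proof eventually_elim
    case (elim n)
    show ?case
    proof
      fix t assume t: "t \<in> {0..T}"
      have "\<bar>frac_int \<alpha> (\<lambda>s. f n s - g s) t\<bar> \<le> e / (2 * C) * C"
        unfolding C_def
        using elim assms g t
        by (intro frac_int_bound continuous_intros) (auto simp: dist_real_def C_def less_imp_le)
      moreover have "frac_int \<alpha> (\<lambda>s. f n s - g s) t = frac_int \<alpha> (f n) t - frac_int \<alpha> g t"
        using assms(1) t
        by (intro frac_int_diff continuous_on_subset[OF assms(3)] continuous_on_subset[OF g]) auto
      ultimately show "dist (frac_int \<alpha> (f n) t) (frac_int \<alpha> g t) < e"
        using C \<open>e > 0\<close> by (simp add: dist_real_def)
    qed
  qed
qed

lemma frac_int_powr:
  assumes "0 < \<alpha>" "-1 < \<gamma>" "0 \<le> t"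
  shows "frac_int \<alpha> (\<lambda>s. s powr \<gamma>) t = Gamma (\<gamma> + 1) / Gamma (\<gamma> + 1 + \<alpha>) * t powr (\<gamma> + \<alpha>)"
  using has_integral_kernel_powr[OF assms] assms(1) by (simp add: frac_int_def has_integral_iff)

lemma frac_int_power:
  assumes "0 < \<alpha>" "0 \<le> t"
  shows "frac_int \<alpha> (\<lambda>s. s ^ i) t = fact i / Gamma (real i + 1 + \<alpha>) * t powr (real i + \<alpha>)"
proof -
  have "frac_int \<alpha> (\<lambda>s. s ^ i) t = frac_int \<alpha> (\<lambda>s. s powr real i) t"
    using assms(1) powr_realpow unfolding frac_int_def
    by (auto intro!: integral_spike[of "{0}"]) (metis order_less_le)
  then show ?thesis
    using frac_int_powr[of \<alpha> "real i" t] assms Gamma_fact[of i, where ?'a = real] by (simp add: add.commute)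
qed

lemma frac_int_polynomial:
  assumes "0 < \<alpha>" "0 \<le> t"
  shows "frac_int \<alpha> (\<lambda>s. \<Sum>i\<le>n. c i * s ^ i) t
    = (\<Sum>i\<le>n. c i * (fact i / Gamma (real i + 1 + \<alpha>) * t powr (real i + \<alpha>)))"
  using assms by (simp add: frac_int_sum frac_int_cmult frac_int_power continuous_intros)

section \<open>The semigroup law\<close>

text \<open>
  Fractional integrals of monomials are explicit and fractional integration respects uniform limits,
  so Weierstrass approximation extends facts about monomials to all continuous functions.
\<close>

lemma obtain_polynomial_approximation:
  fixes f :: "real \<Rightarrow> real"
  assumes "continuous_on {0..T} f"
  obtains c N where "uniform_limit {0..T} (\<lambda>n s. \<Sum>i\<le>N n. c n i * s ^ i) f sequentially"
proof -
  obtain p :: "nat \<Rightarrow> real \<Rightarrow> real" where p: "uniform_limit {0..T} p f sequentially"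
    and poly: "\<And>n. polynomial_function (p n)"
    using Stone_Weierstrass_uniform_limit[OF compact_Icc assms] by blast
  have "\<exists>c N. p n = (\<lambda>s. \<Sum>i\<le>N. c i * s ^ i)" for n
    using poly[of n] real_polynomial_function_iff_sum real_polynomial_function_eq by blast
  then obtain c N where "\<And>n. p n = (\<lambda>s. \<Sum>i\<le>N n. c n i * s ^ i)" by metis
  then have "p = (\<lambda>n s. \<Sum>i\<le>N n. c n i * s ^ i)" by blast
  with p that show thesis by blast
qed

lemma continuous_on_frac_int:
  assumes "0 \<le> \<alpha>" "0 < T" "continuous_on {0..T} f"
  shows "continuous_on {0..T} (frac_int \<alpha> f)"
proof (cases "\<alpha> = 0")
  case True
  then show ?thesis using assms by (simp add: frac_int_def[abs_def])
next
  case False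
  with assms have \<alpha>: "\<alpha> > 0" by simp
  obtain c N where lim: "uniform_limit {0..T} (\<lambda>n s. \<Sum>i\<le>N n. c n i * s ^ i) f sequentially"
    using obtain_polynomial_approximation[OF assms(3)] .
  have "continuous_on {0..T} (frac_int \<alpha> (\<lambda>s. \<Sum>i\<le>N n. c n i * s ^ i))" for n
  proof (rule continuous_on_eq)
    show "continuous_on {0..T} (\<lambda>t. \<Sum>i\<le>N n. c n i * (fact i / Gamma (real i + 1 + \<alpha>) * t powr (real i + \<alpha>)))"
      using \<alpha> by (intro continuous_intros continuous_on_powr') auto
  qed (use \<alpha> in \<open>simp add: frac_int_polynomial\<close>)
  then show ?thesis
    by (intro uniform_limit_theorem[OF _ uniform_limit_frac_int[OF assms(1,2) _ lim]])
       (auto intro!: always_eventually continuous_intros)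
qed

lemma frac_int_semigroup_power:
  assumes "0 < \<alpha>" "0 < \<beta>" "0 \<le> t"
  shows "frac_int \<alpha> (frac_int \<beta> (\<lambda>s. s ^ i)) t = frac_int (\<alpha> + \<beta>) (\<lambda>s. s ^ i) t"
proof -
  have pos: "Gamma (real i + 1 + \<beta>) > 0"
    using assms by (intro Gamma_real_pos) linarith
  have "frac_int \<alpha> (frac_int \<beta> (\<lambda>s. s ^ i)) t
      = frac_int \<alpha> (\<lambda>s. fact i / Gamma (real i + 1 + \<beta>) * s powr (real i + \<beta>)) t"
    using assms by (intro frac_int_cong) (auto simp: frac_int_power)
  also have "\<dots> = fact i / Gamma (real i + 1 + \<beta>) *
      (Gamma (real i + \<beta> + 1) / Gamma (real i + \<beta> + 1 + \<alpha>) * t powr (real i + \<beta> + \<alpha>))"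
    unfolding frac_int_cmult using assms by (subst frac_int_powr) auto
  also have "\<dots> = frac_int (\<alpha> + \<beta>) (\<lambda>s. s ^ i) t"
    unfolding frac_int_power[OF add_pos_pos[OF assms(1,2)] assms(3)]
    using pos by (simp add: add_ac)
  finally show ?thesis .
qed

text \<open>
  On monomials the law is cancellation of the \<open>Gamma\<close> factors produced by two Beta integrals; density
  of polynomials does the rest, without interchanging the order of a double integral.
\<close>

theorem frac_int_semigroup:
  assumes "0 \<le> \<alpha>" "0 \<le> \<beta>" "0 < T" "continuous_on {0..T} f" "t \<in> {0..T}"
  shows "frac_int \<alpha> (frac_int \<beta> f) t = frac_int (\<alpha> + \<beta>) f t"
proof (cases "\<alpha> = 0 \<or> \<beta> = 0")
  case True
  then show ?thesis by (auto simp: frac_int_def[abs_def])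
next
  case False
  with assms have pos: "\<alpha> > 0" "\<beta> > 0" by auto
  obtain c N where lim: "uniform_limit {0..T} (\<lambda>n s. \<Sum>i\<le>N n. c n i * s ^ i) f sequentially"
    using obtain_polynomial_approximation[OF assms(4)] .
  define p where "p n s = (\<Sum>i\<le>N n. c n i * s ^ i)" for n s
  have p: "uniform_limit {0..T} p f sequentially"
    using lim by (simp add: p_def[abs_def])
  have cont_p: "continuous_on {0..T} (p n)" for n
    unfolding p_def by (intro continuous_intros)
  have mono_cont: "continuous_on {0..t} (frac_int \<beta> (\<lambda>s. s ^ i))" for i
    by (rule continuous_on_subset[OF continuous_on_frac_int[OF assms(2,3)]])
       (use assms in \<open>auto intro!: continuous_intros\<close>)
  have "frac_int \<alpha> (frac_int \<beta> (p n)) t = frac_int (\<alpha> + \<beta>) (p n) t" for n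
  proof -
    have "frac_int \<alpha> (frac_int \<beta> (p n)) t
        = frac_int \<alpha> (\<lambda>s. \<Sum>i\<le>N n. c n i * frac_int \<beta> (\<lambda>s. s ^ i) s) t"
      using assms unfolding p_def
      by (intro frac_int_cong) (auto simp: frac_int_sum frac_int_cmult continuous_intros)
    also have "\<dots> = (\<Sum>i\<le>N n. c n i * frac_int \<alpha> (frac_int \<beta> (\<lambda>s. s ^ i)) t)"
      using assms(1) mono_cont by (simp add: frac_int_sum frac_int_cmult continuous_intros)
    also have "\<dots> = frac_int (\<alpha> + \<beta>) (p n) t"
      using assms pos unfolding p_def
      by (simp add: frac_int_semigroup_power frac_int_sum frac_int_cmult continuous_intros)
    finally show ?thesis .
  qed
  moreover have "(\<lambda>n. frac_int \<alpha> (frac_int \<beta> (p n)) t) \<longlonglongrightarrow> frac_int \<alpha> (frac_int \<beta> f) t"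
    by (rule tendsto_uniform_limitI[OF _ assms(5)])
       (intro uniform_limit_frac_int continuous_on_frac_int assms cont_p p)
  moreover have "(\<lambda>n. frac_int (\<alpha> + \<beta>) (p n) t) \<longlonglongrightarrow> frac_int (\<alpha> + \<beta>) f t"
    by (rule tendsto_uniform_limitI[OF _ assms(5)])
       (use assms in \<open>intro uniform_limit_frac_int cont_p p; simp\<close>)
  ultimately show ?thesis
    using LIMSEQ_unique by auto
qed

section \<open>The fractional equation with continuous data\<close>

lemma frac_int_suminf:
  fixes f :: "nat \<Rightarrow> real \<Rightarrow> real"
  assumes "0 \<le> \<alpha>" "0 < T" "\<And>k. continuous_on {0..T} (f k)"
    and "\<And>k s. s \<in> {0..T} \<Longrightarrow> \<bar>f k s\<bar> \<le> M k" "summable M" "t \<in> {0..T}"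
  shows "(\<lambda>k. frac_int \<alpha> (f k) t) sums frac_int \<alpha> (\<lambda>s. \<Sum>k. f k s) t"
proof -
  have "uniform_limit {0..T} (\<lambda>n s. \<Sum>k<n. f k s) (\<lambda>s. \<Sum>k. f k s) sequentially"
    using assms(4,5) by (intro Weierstrass_m_test) auto
  then have "uniform_limit {0..T} (\<lambda>n. frac_int \<alpha> (\<lambda>s. \<Sum>k<n. f k s))
      (frac_int \<alpha> (\<lambda>s. \<Sum>k. f k s)) sequentially"
    using assms(1-3) by (intro uniform_limit_frac_int continuous_intros) auto
  then have "(\<lambda>n. frac_int \<alpha> (\<lambda>s. \<Sum>k<n. f k s) t) \<longlonglongrightarrow> frac_int \<alpha> (\<lambda>s. \<Sum>k. f k s) t"
    using assms(6) by (rule tendsto_uniform_limitI)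
  moreover have "frac_int \<alpha> (\<lambda>s. \<Sum>k<n. f k s) t = (\<Sum>k<n. frac_int \<alpha> (f k) t)" for n
    using assms(1,6) by (intro frac_int_sum continuous_on_subset[OF assms(3)]) auto
  ultimately show ?thesis by (simp add: sums_def)
qed

lemma continuous_on_suminf:
  fixes f :: "nat \<Rightarrow> real \<Rightarrow> real"
  assumes "\<And>k. continuous_on A (f k)" "\<And>k s. s \<in> A \<Longrightarrow> \<bar>f k s\<bar> \<le> M k" "summable M"
  shows "continuous_on A (\<lambda>s. \<Sum>k. f k s)"
proof (rule uniform_limit_theorem)
  show "uniform_limit A (\<lambda>n s. \<Sum>k<n. f k s) (\<lambda>s. \<Sum>k. f k s) sequentially"
    using assms(2,3) by (intro Weierstrass_m_test) auto
  show "\<forall>\<^sub>F n in sequentially. continuous_on A (\<lambda>s. \<Sum>k<n. f k s)"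
    using assms(1) by (intro always_eventually allI continuous_intros)
qed simp

lemma frac_int_1_has_vector_derivative:
  assumes "continuous_on {0..T} f" "t \<in> {0..T}"
  shows "(frac_int 1 f has_vector_derivative f t) (at t within {0..T})"
  using integral_has_vector_derivative[OF assms] by (simp add: frac_int_1[abs_def])

lemma frac_int_1_eqD:
  assumes "0 < T" "continuous_on {0..T} f" "continuous_on {0..T} g"
    and "\<And>t. t \<in> {0..T} \<Longrightarrow> frac_int 1 f t = frac_int 1 g t" and "t \<in> {0..T}"
  shows "f t = g t"
proof -
  have "(frac_int 1 g has_vector_derivative g t) (at t within {0..T})"
    using frac_int_1_has_vector_derivative assms by blast
  then have "(frac_int 1 f has_vector_derivative g t) (at t within {0..T})"
    by (rule has_vector_derivative_transform[OF assms(5), rotated]) (rule assms(4))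
  then show ?thesis
    using vector_derivative_unique_within_closed_interval[of 0 T t "frac_int 1 f" "f t" "g t"]
      frac_int_1_has_vector_derivative[OF assms(2,5)] assms(1,5) by simp
qed

text \<open>
  Integrating further, up to total order \<open>1\<close>, reduces the injectivity of fractional integration to that
  of the ordinary primitive, which can be differentiated.
\<close>

lemma frac_int_eqD:
  assumes "0 \<le> \<alpha>" "\<alpha> \<le> 1" "0 < T" "continuous_on {0..T} f" "continuous_on {0..T} g"
    and eq: "\<And>t. t \<in> {0..T} \<Longrightarrow> frac_int \<alpha> f t = frac_int \<alpha> g t" and "t \<in> {0..T}"
  shows "f t = g t"
proof (rule frac_int_1_eqD[OF assms(3-5) _ assms(7)])
  fix t assume t: "t \<in> {0..T}"
  have "frac_int (1 - \<alpha>) (frac_int \<alpha> f) t = frac_int (1 - \<alpha>) (frac_int \<alpha> g) t"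
    using t eq by (subst frac_int_cong[where g = "frac_int \<alpha> g"]) auto
  then show "frac_int 1 f t = frac_int 1 g t"
    using assms t by (simp add: frac_int_semigroup)
qed

lemma powr_mult_power:
  fixes T \<beta> \<omega> :: real
  assumes "0 < T"
  shows "\<omega> ^ k * T powr (\<beta> * real k) = (\<omega> * T powr \<beta>) ^ k"
  using assms by (simp add: power_mult_distrib powr_power mult.commute)

text \<open>
  The inverse of \<open>id + \<omega> * frac_int \<beta>\<close> as a geometric series, the powers of \<open>frac_int \<beta>\<close> being written
  as fractional integrals by the semigroup law.
\<close>

definition neumann_series :: "real \<Rightarrow> real \<Rightarrow> (real \<Rightarrow> real) \<Rightarrow> real \<Rightarrow> real" where
  "neumann_series \<omega> \<beta> h t = (\<Sum>k. (-\<omega>) ^ k * frac_int (\<beta> * real k) h t)"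

context
  fixes T \<beta> \<omega> :: real
  assumes T: "0 < T" and \<beta>: "0 < \<beta>" "\<beta> \<le> 1"
begin

text \<open>
  The \<open>k\<close>-th term is dominated by the \<open>k\<close>-th term of a Mittag-Leffler series; the convergence of the
  Neumann series and the uniqueness of its sum both rest on this.
\<close>

lemma frac_int_iterate_bound:
  assumes "continuous_on {0..T} h" "\<And>s. s \<in> {0..T} \<Longrightarrow> \<bar>h s\<bar> \<le> M" "t \<in> {0..T}"
  shows "\<bar>(-\<omega>) ^ k * frac_int (\<beta> * real k) h t\<bar>
    \<le> M * ((\<bar>\<omega>\<bar> * T powr \<beta>) ^ k / Gamma (\<beta> * real k + 1))"
proof -
  have "\<bar>\<omega>\<bar> ^ k * \<bar>frac_int (\<beta> * real k) h t\<bar>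
      \<le> \<bar>\<omega>\<bar> ^ k * (M * (T powr (\<beta> * real k) / Gamma (\<beta> * real k + 1)))"
    using assms T \<beta> by (intro mult_left_mono frac_int_bound) auto
  also have "\<dots> = M * ((\<bar>\<omega>\<bar> ^ k * T powr (\<beta> * real k)) / Gamma (\<beta> * real k + 1))"
    by simp
  finally show ?thesis
    unfolding powr_mult_power[OF T] by (simp add: abs_mult power_abs)
qed

lemma obtain_frac_int_iterate_bound:
  assumes "continuous_on {0..T} h"
  obtains M where "summable M"
    "\<And>k t. t \<in> {0..T} \<Longrightarrow> \<bar>(-\<omega>) ^ k * frac_int (\<beta> * real k) h t\<bar> \<le> M k"
proof -
  have "bounded (h ` {0..T})"
    using assms compact_continuous_image compact_imp_bounded by blast
  then obtain C where "\<And>s. s \<in> {0..T} \<Longrightarrow> \<bar>h s\<bar> \<le> C"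
    unfolding bounded_iff real_norm_def by blast
  then show thesis
    using \<beta> assms
    by (intro that[of "\<lambda>k. C * ((\<bar>\<omega>\<bar> * T powr \<beta>) ^ k / Gamma (\<beta> * real k + 1))"]
        summable_mult summable_mittag_leffler frac_int_iterate_bound) auto
qed

lemma continuous_on_neumann_series:
  assumes "continuous_on {0..T} h"
  shows "continuous_on {0..T} (neumann_series \<omega> \<beta> h)"
proof -
  obtain M where "summable M"
    "\<And>k t. t \<in> {0..T} \<Longrightarrow> \<bar>(-\<omega>) ^ k * frac_int (\<beta> * real k) h t\<bar> \<le> M k"
    using obtain_frac_int_iterate_bound[OF assms] by blast
  then show ?thesis
    unfolding neumann_series_def[abs_def] using T \<beta> assms
    by (intro continuous_on_suminf[where M = M] continuous_intros continuous_on_frac_int) auto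
qed

lemma frac_int_neumann_series_sums:
  assumes "continuous_on {0..T} h" "0 \<le> \<alpha>" "t \<in> {0..T}"
  shows "(\<lambda>k. (-\<omega>) ^ k * frac_int (\<alpha> + \<beta> * real k) h t) sums frac_int \<alpha> (neumann_series \<omega> \<beta> h) t"
proof -
  obtain M where M: "summable M"
    "\<And>k t. t \<in> {0..T} \<Longrightarrow> \<bar>(-\<omega>) ^ k * frac_int (\<beta> * real k) h t\<bar> \<le> M k"
    using obtain_frac_int_iterate_bound[OF assms(1)] by blast
  have "(\<lambda>k. frac_int \<alpha> (\<lambda>s. (-\<omega>) ^ k * frac_int (\<beta> * real k) h s) t)
      sums frac_int \<alpha> (\<lambda>s. \<Sum>k. (-\<omega>) ^ k * frac_int (\<beta> * real k) h s) t"
    using T \<beta> assms M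
    by (intro frac_int_suminf[where M = M and T = T] continuous_intros continuous_on_frac_int) auto
  moreover have "frac_int \<alpha> (\<lambda>s. (-\<omega>) ^ k * frac_int (\<beta> * real k) h s) t
      = (-\<omega>) ^ k * frac_int (\<alpha> + \<beta> * real k) h t" for k
    using T \<beta> assms by (simp add: frac_int_cmult frac_int_semigroup)
  ultimately show ?thesis by (simp add: neumann_series_def[abs_def])
qed

text \<open>
  Applying \<open>- \<omega> * frac_int \<beta>\<close> to the series shifts its index by one.
\<close>

lemma neumann_series_equation:
  assumes "continuous_on {0..T} h" "t \<in> {0..T}"
  shows "neumann_series \<omega> \<beta> h t + \<omega> * frac_int \<beta> (neumann_series \<omega> \<beta> h) t = h t"
proof -
  let ?a = "\<lambda>k. (-\<omega>) ^ k * frac_int (\<beta> * real k) h t"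
  have "?a sums neumann_series \<omega> \<beta> h t"
    using frac_int_neumann_series_sums[OF assms(1) order_refl assms(2)] by simp
  then have "(\<lambda>k. ?a (Suc k)) sums (neumann_series \<omega> \<beta> h t - h t)"
    by (subst sums_Suc_iff) simp
  moreover have "(\<lambda>k. -\<omega> * ((-\<omega>) ^ k * frac_int (\<beta> + \<beta> * real k) h t)) sums
      (-\<omega> * frac_int \<beta> (neumann_series \<omega> \<beta> h) t)"
    using \<beta> assms by (intro sums_mult frac_int_neumann_series_sums) auto
  moreover have "?a (Suc k) = -\<omega> * ((-\<omega>) ^ k * frac_int (\<beta> + \<beta> * real k) h t)" for k
    by (simp add: distrib_left)
  ultimately have "neumann_series \<omega> \<beta> h t - h t = -\<omega> * frac_int \<beta> (neumann_series \<omega> \<beta> h) t"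
    by (simp only: sums_unique2)
  then show ?thesis by simp
qed

text \<open>
  Iterating \<open>d = - \<omega> * frac_int \<beta> d\<close> exhibits \<open>d\<close> as each term of the Neumann series of \<open>d\<close>, and
  these terms tend to \<open>0\<close>.
\<close>

lemma homogeneous_equation_zero:
  assumes "continuous_on {0..T} d" "t \<in> {0..T}"
    and eq: "\<And>t. t \<in> {0..T} \<Longrightarrow> d t + \<omega> * frac_int \<beta> d t = 0"
  shows "d t = 0"
proof -
  have d: "d t = -\<omega> * frac_int \<beta> d t" if "t \<in> {0..T}" for t
    using eq[OF that] by simp
  have iter: "d t = (-\<omega>) ^ k * frac_int (\<beta> * real k) d t" if "t \<in> {0..T}" for k t
    using that
  proof (induction k arbitrary: t)
    case 0
    then show ?case by simp
  next
    case (Suc k)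
    have "frac_int \<beta> d t = frac_int \<beta> (\<lambda>s. (-\<omega>) ^ k * frac_int (\<beta> * real k) d s) t"
      using Suc by (intro frac_int_cong) auto
    also have "\<dots> = (-\<omega>) ^ k * frac_int (\<beta> * real (Suc k)) d t"
      using T \<beta> assms(1) Suc.prems
      by (simp add: frac_int_cmult frac_int_semigroup algebra_simps)
    finally show ?case using d[OF Suc.prems] by simp
  qed
  obtain M where "summable M"
    "\<And>k t. t \<in> {0..T} \<Longrightarrow> \<bar>(-\<omega>) ^ k * frac_int (\<beta> * real k) d t\<bar> \<le> M k"
    using obtain_frac_int_iterate_bound[OF assms(1)] by blast
  then have "M \<longlonglongrightarrow> 0" "\<And>k. \<bar>d t\<bar> \<le> M k"
    using assms(2) iter[OF assms(2)] summable_LIMSEQ_zero[of M] by metis+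
  then have "\<bar>d t\<bar> \<le> 0"
    by (meson LIMSEQ_le_const)
  then show ?thesis by simp
qed

lemma neumann_series_unique:
  assumes "continuous_on {0..T} h" "continuous_on {0..T} p" "t \<in> {0..T}"
    and eq: "\<And>t. t \<in> {0..T} \<Longrightarrow> p t + \<omega> * frac_int \<beta> p t = h t"
  shows "p t = neumann_series \<omega> \<beta> h t"
proof -
  have "p t - neumann_series \<omega> \<beta> h t = 0"
  proof (rule homogeneous_equation_zero[OF _ assms(3)])
    fix t assume t: "t \<in> {0..T}"
    have "frac_int \<beta> (\<lambda>t. p t - neumann_series \<omega> \<beta> h t) t = frac_int \<beta> p t - frac_int \<beta> (neumann_series \<omega> \<beta> h) t"
      using \<beta> t
      by (intro frac_int_diff continuous_on_subset[OF assms(2)]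
          continuous_on_subset[OF continuous_on_neumann_series[OF assms(1)]]) auto
    then show "p t - neumann_series \<omega> \<beta> h t + \<omega> * frac_int \<beta> (\<lambda>t. p t - neumann_series \<omega> \<beta> h t) t = 0"
      using eq[OF t] neumann_series_equation[OF assms(1) t] by (simp add: right_diff_distrib)
  qed (intro continuous_intros assms continuous_on_neumann_series)
  then show ?thesis by simp
qed

end

text \<open>
  The source of the Mittag-Leffler kernel.  The \<open>k\<close>-th term of the Neumann series, integrated to order
  \<open>\<mu>\<close>, is the convolution of \<open>h\<close> with \<open>s powr (\<mu> + \<beta> * k - 1) / Gamma (\<mu> + \<beta> * k)\<close>.  Once the
  singular factor \<open>s powr (\<mu> - 1)\<close> is split off, these kernels sum uniformly to a continuous function,
  so summation and integration commute.
\<close>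

lemma frac_int_mittag_leffler:
  fixes t \<beta> \<mu> \<omega> :: real and h :: "real \<Rightarrow> real"
  assumes "0 < t" "0 < \<beta>" "\<beta> \<le> 1" "0 < \<mu>" "continuous_on {0..t} h"
  defines "E \<equiv> \<lambda>s. mittag_leffler \<beta> \<mu> (- \<omega> * (t - s) powr \<beta>)"
  shows "continuous_on {0..t} (\<lambda>s. Gamma \<mu> * E s * h s)"
    and "frac_int \<mu> (neumann_series \<omega> \<beta> h) t = frac_int \<mu> (\<lambda>s. Gamma \<mu> * E s * h s) t"
proof -
  \<comment> \<open>The factor \<open>Gamma \<mu>\<close> cancels the normalisation in \<open>frac_int \<mu>\<close>.  Powers of \<open>(t - s) powr \<beta>\<close> are used
    because \<open>(t - s) powr (\<beta> * k)\<close> is discontinuous at \<open>s = t\<close> for \<open>k = 0\<close>.\<close>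
  define f where "f k s = Gamma \<mu> * ((- \<omega> * (t - s) powr \<beta>) ^ k / Gamma (\<beta> * real k + \<mu>)) * h s" for k s
  have "bounded (h ` {0..t})"
    using assms(5) compact_continuous_image compact_imp_bounded by blast
  then obtain C where C: "\<And>s. s \<in> {0..t} \<Longrightarrow> \<bar>h s\<bar> \<le> C"
    unfolding bounded_iff real_norm_def by blast
  define M where "M k = Gamma \<mu> * ((\<bar>\<omega>\<bar> * t powr \<beta>) ^ k / Gamma (\<beta> * real k + \<mu>)) * C" for k
  have "summable M"
    unfolding M_def using assms by (intro summable_mult summable_mult2 summable_mittag_leffler)
  have pos: "Gamma (\<beta> * real k + \<mu>) > 0" for k
    using assms by (intro Gamma_real_pos add_nonneg_pos) auto
  have bound: "\<bar>f k s\<bar> \<le> M k" if "s \<in> {0..t}" for k s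
  proof -
    have "\<bar>f k s\<bar> = Gamma \<mu> * ((\<bar>\<omega>\<bar> * (t - s) powr \<beta>) ^ k / Gamma (\<beta> * real k + \<mu>)) * \<bar>h s\<bar>"
      using pos[of k] assms(4) by (simp add: f_def abs_mult power_abs)
    also have "\<dots> \<le> M k"
      unfolding M_def using that C[OF that] pos[of k] assms
      by (intro mult_mono mult_left_mono divide_right_mono power_mono powr_mono2) auto
    finally show ?thesis .
  qed
  have cont: "continuous_on {0..t} (f k)" for k
    unfolding f_def using assms pos[of k]
    by (intro continuous_intros continuous_on_powr') auto
  have sum_f: "(\<Sum>k. f k s) = Gamma \<mu> * E s * h s" for s
  proof -
    have "summable (\<lambda>k. (- \<omega> * (t - s) powr \<beta>) ^ k / Gamma (\<beta> * real k + \<mu>))"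
      using assms by (intro summable_mittag_leffler)
    then show ?thesis
      unfolding f_def E_def mittag_leffler_def
      by (simp only: suminf_mult suminf_mult2[symmetric] summable_mult)
  qed
  show "continuous_on {0..t} (\<lambda>s. Gamma \<mu> * E s * h s)"
    using continuous_on_suminf[OF cont bound \<open>summable M\<close>] by (simp only: sum_f)
  have "(\<lambda>k. frac_int \<mu> (f k) t) sums frac_int \<mu> (\<lambda>s. Gamma \<mu> * E s * h s) t"
    using frac_int_suminf[OF _ _ cont bound \<open>summable M\<close>, of \<mu> t] assms by (simp add: sum_f)
  moreover have "frac_int \<mu> (f k) t = (-\<omega>) ^ k * frac_int (\<mu> + \<beta> * real k) h t" for k
  proof -
    have "(t - s) powr (\<mu> - 1) / Gamma \<mu> * f k s
        = (t - s) powr (\<mu> + \<beta> * real k - 1) / Gamma (\<mu> + \<beta> * real k) * ((-\<omega>) ^ k * h s)"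
      if "s \<in> {0..t}" for s
    proof (cases "s = t")
      case False
      with that have "t - s > 0" by simp
      moreover have "Gamma \<mu> > 0" using assms by simp
      moreover have "(t - s) powr (\<mu> + \<beta> * real k - 1) = (t - s) powr (\<mu> - 1) * (t - s) powr (\<beta> * real k)"
        by (simp add: powr_add[symmetric] algebra_simps)
      ultimately show ?thesis
        using powr_mult_power[of "t - s" "-\<omega>" k \<beta>, symmetric] unfolding f_def
        by (simp add: field_simps)
    qed simp
    then have "integral {0..t} (\<lambda>s. (t - s) powr (\<mu> - 1) / Gamma \<mu> * f k s)
        = integral {0..t} (\<lambda>s. (t - s) powr (\<mu> + \<beta> * real k - 1) / Gamma (\<mu> + \<beta> * real k) *
            ((-\<omega>) ^ k * h s))"
      by (rule integral_cong)
    moreover have "\<mu> + \<beta> * real k \<noteq> 0"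
      using assms by (smt (verit) mult_nonneg_nonneg of_nat_0_le_iff)
    ultimately have "frac_int \<mu> (f k) t = frac_int (\<mu> + \<beta> * real k) (\<lambda>s. (-\<omega>) ^ k * h s) t"
      using less_imp_neq[OF assms(4), symmetric] unfolding frac_int_def
      by (simp only: if_False simp_thms)
    then show ?thesis by (simp only: frac_int_cmult)
  qed
  moreover have "(\<lambda>k. (-\<omega>) ^ k * frac_int (\<mu> + \<beta> * real k) h t) sums frac_int \<mu> (neumann_series \<omega> \<beta> h) t"
    using assms by (intro frac_int_neumann_series_sums[where T = t]) auto
  ultimately show "frac_int \<mu> (neumann_series \<omega> \<beta> h) t = frac_int \<mu> (\<lambda>s. Gamma \<mu> * E s * h s) t"
    using sums_unique2 by auto
qed

context
  fixes T \<kappa> \<mu> \<omega> :: real and h :: "real \<Rightarrow> real"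
  assumes T: "0 < T" and orders: "0 < \<kappa>" "\<kappa> < \<mu>" "\<mu> \<le> 1" and h: "continuous_on {0..T} h"
begin

text \<open>
  These identities say that \<open>y = frac_int \<mu> g\<close> is a solution: \<open>g\<close> and \<open>frac_int (\<mu> - \<kappa>) g\<close> are its
  derivatives of order \<open>\<mu>\<close> and \<open>\<kappa>\<close>.
\<close>

lemma frac_equation_solution:
  defines "g \<equiv> neumann_series \<omega> (\<mu> - \<kappa>) h"
  assumes "t \<in> {0..T}"
  shows "frac_int (1 - \<mu>) (frac_int \<mu> g) t = frac_int 1 g t"
    and "frac_int (1 - \<kappa>) (frac_int \<mu> g) t = frac_int 1 (frac_int (\<mu> - \<kappa>) g) t"
    and "g t + \<omega> * frac_int (\<mu> - \<kappa>) g t = h t"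
proof -
  have g: "continuous_on {0..T} g"
    unfolding g_def using T orders h by (intro continuous_on_neumann_series) auto
  show "frac_int (1 - \<mu>) (frac_int \<mu> g) t = frac_int 1 g t"
    "frac_int (1 - \<kappa>) (frac_int \<mu> g) t = frac_int 1 (frac_int (\<mu> - \<kappa>) g) t"
    using T orders g assms(2) by (simp_all add: frac_int_semigroup[where T = T] algebra_simps)
  show "g t + \<omega> * frac_int (\<mu> - \<kappa>) g t = h t"
    unfolding g_def using T orders h assms(2) by (intro neumann_series_equation[where T = T]) auto
qed

text \<open>
  Here \<open>p\<close> and \<open>q\<close> are the derivatives of \<open>y\<close> of order \<open>\<mu>\<close> and \<open>\<kappa>\<close>.  Injectivity gives
  \<open>y = frac_int \<mu> p = frac_int \<kappa> q\<close>, hence \<open>q = frac_int (\<mu> - \<kappa>) p\<close>, and the equation becomes the one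
  that only the Neumann series solves.
\<close>

lemma frac_equation_unique:
  assumes cont: "continuous_on {0..T} y" "continuous_on {0..T} p" "continuous_on {0..T} q"
    and p: "\<And>t. t \<in> {0..T} \<Longrightarrow> frac_int (1 - \<mu>) y t = frac_int 1 p t"
    and q: "\<And>t. t \<in> {0..T} \<Longrightarrow> frac_int (1 - \<kappa>) y t = frac_int 1 q t"
    and eq: "\<And>t. t \<in> {0..T} \<Longrightarrow> p t + \<omega> * q t = h t"
    and t: "t \<in> {0..T}"
  shows "y t = frac_int \<mu> (neumann_series \<omega> (\<mu> - \<kappa>) h) t"
proof -
  have inv: "y t = frac_int \<alpha> r t"
    if "0 < \<alpha>" "\<alpha> \<le> 1" "continuous_on {0..T} r" "t \<in> {0..T}"
      "\<And>t. t \<in> {0..T} \<Longrightarrow> frac_int (1 - \<alpha>) y t = frac_int 1 r t" for \<alpha> r t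
  proof (rule frac_int_eqD[where \<alpha> = "1 - \<alpha>" and T = T and f = y and g = "frac_int \<alpha> r"])
    fix t assume "t \<in> {0..T}"
    then show "frac_int (1 - \<alpha>) y t = frac_int (1 - \<alpha>) (frac_int \<alpha> r) t"
      using that T by (simp add: frac_int_semigroup)
  qed (use that T cont in \<open>auto intro: continuous_on_frac_int\<close>)
  have y_p: "y t = frac_int \<mu> p t" and y_q: "y t = frac_int \<kappa> q t" if "t \<in> {0..T}" for t
    using inv[of \<mu> p t] inv[of \<kappa> q t] that orders cont p q by auto
  have q_p: "q t = frac_int (\<mu> - \<kappa>) p t" if t: "t \<in> {0..T}" for t
  proof (rule frac_int_eqD[where \<alpha> = \<kappa> and T = T and f = q and g = "frac_int (\<mu> - \<kappa>) p"])
    fix t assume "t \<in> {0..T}"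
    then show "frac_int \<kappa> q t = frac_int \<kappa> (frac_int (\<mu> - \<kappa>) p) t"
      using y_p y_q T orders cont by (simp add: frac_int_semigroup)
  qed (use t T orders cont in \<open>auto intro: continuous_on_frac_int\<close>)
  have "p t = neumann_series \<omega> (\<mu> - \<kappa>) h t" if t: "t \<in> {0..T}" for t
    using T orders h cont t q_p eq by (intro neumann_series_unique[where T = T]) auto
  then show ?thesis
    using y_p[OF t] t frac_int_cong[of t p _ \<mu>] by auto
qed

end

section \<open>The change of time scale\<close>

locale time_change =
  fixes a b :: real and \<Phi> :: "real \<Rightarrow> real"
  assumes a_less_b: "a < b" and C1_\<Phi>: "C1_on a b \<Phi>" and mono_\<Phi>: "mono_on {a..b} \<Phi>"
    and deriv_\<Phi>_neq_0: "\<And>l. l \<in> {a..b} \<Longrightarrow> vector_derivative \<Phi> (at l within {a..b}) \<noteq> 0"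
begin

abbreviation d\<Phi> :: "real \<Rightarrow> real" where
  "d\<Phi> l \<equiv> vector_derivative \<Phi> (at l within {a..b})"

text \<open>
  Measured by the clock \<open>\<Phi> l - \<Phi> a\<close>, which runs from \<open>0\<close> to \<open>horizon\<close>, fractional calculus with respect
  to \<open>\<Phi>\<close> is ordinary fractional calculus.
\<close>

definition clock :: "real \<Rightarrow> real" where "clock l = \<Phi> l - \<Phi> a"

definition clock_inv :: "real \<Rightarrow> real" where "clock_inv = inv_into {a..b} clock"

abbreviation horizon :: real where "horizon \<equiv> clock b"

lemma C1_on_has_derivative:
  assumes "C1_on a b P" "l \<in> {a..b}"
  shows "(P has_real_derivative vector_derivative P (at l within {a..b})) (at l within {a..b})"
  using assms unfolding C1_on_def differentiable_on_def
  by (simp add: has_real_derivative_iff_has_vector_derivative vector_derivative_works)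

lemma C1_onI:
  assumes "\<And>l. l \<in> {a..b} \<Longrightarrow> (P has_real_derivative P' l) (at l within {a..b})"
    and "continuous_on {a..b} P'"
  shows "C1_on a b P"
    and "l \<in> {a..b} \<Longrightarrow> vector_derivative P (at l within {a..b}) = P' l"
proof -
  show eq: "vector_derivative P (at l within {a..b}) = P' l" if "l \<in> {a..b}" for l
    using assms(1)[OF that] that a_less_b
    by (simp add: has_real_derivative_iff_has_vector_derivative vector_derivative_within_closed_interval)
  have "P differentiable_on {a..b}"
    using assms(1) unfolding differentiable_on_def real_differentiable_def by blast
  then show "C1_on a b P"
    unfolding C1_on_def using continuous_on_eq[OF assms(2)] eq by metis
qed

lemma clock_has_derivative:
  assumes "l \<in> {a..b}"
  shows "(clock has_real_derivative d\<Phi> l) (at l within {a..b})"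
  unfolding clock_def[abs_def] using C1_on_has_derivative[OF C1_\<Phi> assms]
  by (auto intro!: derivative_eq_intros)

text \<open>
  Difference quotients of a monotone function are nonnegative, so a derivative that never vanishes is
  positive.
\<close>

lemma deriv_\<Phi>_pos:
  assumes "l \<in> {a..b}"
  shows "d\<Phi> l > 0"
proof -
  have "((\<lambda>x. (\<Phi> x - \<Phi> l) / (x - l)) \<longlongrightarrow> d\<Phi> l) (at l within {a..b})"
    using C1_on_has_derivative[OF C1_\<Phi> assms] by (simp add: has_field_derivative_iff)
  moreover have "\<forall>\<^sub>F x in at l within {a..b}. 0 \<le> (\<Phi> x - \<Phi> l) / (x - l)"
    unfolding eventually_at_filter
  proof (intro always_eventually allI impI)
    fix x assume "x \<noteq> l" "x \<in> {a..b}"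
    then show "0 \<le> (\<Phi> x - \<Phi> l) / (x - l)"
      using assms mono_onD[OF mono_\<Phi>, of x l] mono_onD[OF mono_\<Phi>, of l x]
      by (cases x l rule: linorder_cases) (auto intro: divide_nonpos_neg)
  qed
  moreover have "at l within {a..b} \<noteq> bot"
    using assms a_less_b by (simp add: trivial_limit_within islimpt_Icc)
  ultimately have "d\<Phi> l \<ge> 0"
    using tendsto_lowerbound by blast
  then show ?thesis
    using deriv_\<Phi>_neq_0[OF assms] by simp
qed

lemma clock_less:
  assumes "x \<in> {a..b}" "y \<in> {a..b}" "x < y"
  shows "clock x < clock y"
proof -
  have "\<exists>\<xi>\<in>{x<..<y}. clock y - clock x = d\<Phi> \<xi> * (y - x)"
  proof (rule mvt_simple[OF assms(3)])
    fix z assume "x \<le> z" "z \<le> y"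
    with assms have "(clock has_real_derivative d\<Phi> z) (at z within {x..y})"
      by (intro DERIV_subset[OF clock_has_derivative]) auto
    then show "(clock has_derivative (*) (d\<Phi> z)) (at z within {x..y})"
      by (rule has_field_derivative_imp_has_derivative)
  qed
  then obtain \<xi> where \<xi>: "\<xi> \<in> {x<..<y}" "clock y - clock x = d\<Phi> \<xi> * (y - x)" by blast
  moreover have "d\<Phi> \<xi> > 0"
    using \<xi>(1) assms by (intro deriv_\<Phi>_pos) auto
  ultimately have "clock y - clock x > 0"
    using assms(3) by simp
  then show ?thesis by simp
qed

lemma inj_on_clock: "inj_on clock {a..b}"
  unfolding inj_on_def by (metis clock_less less_irrefl linorder_less_linear)

lemma continuous_on_clock: "continuous_on {a..b} clock"
  by (rule DERIV_continuous_on) (rule clock_has_derivative)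

lemma clock_a [simp]: "clock a = 0"
  by (simp add: clock_def)

lemma horizon_pos: "0 < horizon"
  using clock_less[of a b] a_less_b by simp

lemma clock_image:
  assumes "l \<in> {a..b}"
  shows "clock ` {a..l} = {0..clock l}"
proof (intro equalityI subsetI)
  fix s assume "s \<in> clock ` {a..l}"
  then obtain x where x: "x \<in> {a..l}" "s = clock x" by auto
  then show "s \<in> {0..clock l}"
    using clock_less[of a x] clock_less[of x l] assms clock_a
    by (cases "x = a"; cases "x = l") (auto simp del: clock_a)
next
  fix s assume "s \<in> {0..clock l}"
  moreover have "continuous_on {a..l} clock"
    using continuous_on_clock assms by (auto intro: continuous_on_subset)
  ultimately show "s \<in> clock ` {a..l}"
    using IVT'[of clock a s l] assms by auto
qed

lemma clock_range: "l \<in> {a..b} \<Longrightarrow> clock l \<in> {0..horizon}"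
  using clock_image[of b] a_less_b by (metis imageI atLeastAtMost_iff less_imp_le order_refl)

lemma clock_inv_clock [simp]: "l \<in> {a..b} \<Longrightarrow> clock_inv (clock l) = l"
  unfolding clock_inv_def using inj_on_clock by (rule inv_into_f_f)

lemma clock_inv_range: "t \<in> {0..horizon} \<Longrightarrow> clock_inv t \<in> {a..b}"
  using clock_image[of b] a_less_b inv_into_into[of t clock "{a..b}"] by (simp add: clock_inv_def)

lemma clock_clock_inv [simp]: "t \<in> {0..horizon} \<Longrightarrow> clock (clock_inv t) = t"
  using clock_image[of b] a_less_b f_inv_into_f[of t clock "{a..b}"] by (simp add: clock_inv_def)

lemma clock_inv_0 [simp]: "clock_inv 0 = a"
  using clock_inv_clock[of a] a_less_b by simp

lemma continuous_on_clock_inv: "continuous_on {0..horizon} clock_inv"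
  using continuous_on_inv[OF continuous_on_clock compact_Icc, of clock_inv]
    clock_image[of b] a_less_b by simp

lemma continuous_on_compose_clock_inv:
  assumes "continuous_on {a..b} f"
  shows "continuous_on {0..horizon} (\<lambda>s. f (clock_inv s))"
  by (rule continuous_on_compose2[OF assms continuous_on_clock_inv]) (use clock_inv_range in auto)

lemma continuous_on_compose_clock:
  assumes "continuous_on {0..horizon} p"
  shows "continuous_on {a..b} (\<lambda>l. p (clock l))"
  by (rule continuous_on_compose2[OF assms continuous_on_clock]) (use clock_range in auto)

lemma integral_clock_substitution:
  assumes "l \<in> {a..b}" "F absolutely_integrable_on {0..clock l}"
  shows "integral {a..l} (\<lambda>\<rho>. d\<Phi> \<rho> * F (clock \<rho>)) = integral {0..clock l} F"
proof -
  have "(\<lambda>\<rho>. \<bar>d\<Phi> \<rho>\<bar> * F (clock \<rho>)) absolutely_integrable_on {a..l} \<and>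
      integral {a..l} (\<lambda>\<rho>. \<bar>d\<Phi> \<rho>\<bar> * F (clock \<rho>)) = integral {0..clock l} F \<longleftrightarrow>
      F absolutely_integrable_on (clock ` {a..l}) \<and>
      integral (clock ` {a..l}) F = integral {0..clock l} F"
  proof (rule has_absolute_integral_change_of_variables_1')
    show "(clock has_real_derivative d\<Phi> x) (at x within {a..l})" if "x \<in> {a..l}" for x
      using that assms(1) by (intro DERIV_subset[OF clock_has_derivative]) auto
    show "inj_on clock {a..l}"
      using assms(1) by (intro inj_on_subset[OF inj_on_clock]) auto
  qed auto
  then have "integral {a..l} (\<lambda>\<rho>. \<bar>d\<Phi> \<rho>\<bar> * F (clock \<rho>)) = integral {0..clock l} F"
    using assms clock_image by simp
  moreover have "integral {a..l} (\<lambda>\<rho>. \<bar>d\<Phi> \<rho>\<bar> * F (clock \<rho>)) = integral {a..l} (\<lambda>\<rho>. d\<Phi> \<rho> * F (clock \<rho>))"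
    using deriv_\<Phi>_pos assms(1) by (intro integral_cong) force
  ultimately show ?thesis by simp
qed

lemma integral_kernel_clock:
  assumes "l \<in> {a..b}" "0 < \<alpha>" "continuous_on {0..clock l} f"
  shows "integral {a..l} (\<lambda>\<rho>. d\<Phi> \<rho> * (\<Phi> l - \<Phi> \<rho>) powr (\<alpha> - 1) / Gamma \<alpha> * f (clock \<rho>))
    = frac_int \<alpha> f (clock l)"
proof -
  have "integral {a..l} (\<lambda>\<rho>. d\<Phi> \<rho> * ((clock l - clock \<rho>) powr (\<alpha> - 1) / Gamma \<alpha> * f (clock \<rho>)))
    = integral {0..clock l} (\<lambda>s. (clock l - s) powr (\<alpha> - 1) / Gamma \<alpha> * f s)"
    using assms by (intro integral_clock_substitution kernel_times_absolutely_integrable)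
  then show ?thesis
    using assms(2) by (simp add: frac_int_def clock_def mult.assoc)
qed

lemma rl_integral_eq_frac_int:
  assumes "l \<in> {a..b}" "0 < \<alpha>" "continuous_on {a..b} z"
  shows "rl_integral a b \<Phi> \<alpha> z l = frac_int \<alpha> (\<lambda>s. z (clock_inv s)) (clock l)"
proof -
  have "rl_integral a b \<Phi> \<alpha> z l = integral {a..l} (\<lambda>\<rho>. d\<Phi> \<rho> * (\<Phi> l - \<Phi> \<rho>) powr (\<alpha> - 1) / Gamma \<alpha> *
      z (clock_inv (clock \<rho>)))"
    unfolding rl_integral_def using assms(1) by (intro integral_cong) auto
  also have "\<dots> = frac_int \<alpha> (\<lambda>s. z (clock_inv s)) (clock l)"
    using clock_range[OF assms(1)] assms
    by (intro integral_kernel_clock continuous_on_subset[OF continuous_on_compose_clock_inv]) auto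
  finally show ?thesis .
qed

text \<open>
  This lemma and the next are the two halves of the fundamental theorem of calculus for
  \<open>(1/\<Phi>') d/dl\<close>, whose primitives in the new time are ordinary primitives.
\<close>

lemma phi_deriv_fundamental:
  assumes "C1_on a b P"
  defines "D \<equiv> phi_deriv a b \<Phi> P"
  shows "continuous_on {a..b} D"
    and "l \<in> {a..b} \<Longrightarrow> P l = P a + frac_int 1 (\<lambda>s. D (clock_inv s)) (clock l)"
proof -
  show D: "continuous_on {a..b} D"
    using assms C1_\<Phi> deriv_\<Phi>_neq_0
    unfolding D_def phi_deriv_def[abs_def] C1_on_def by (intro continuous_intros) auto
  assume l: "l \<in> {a..b}"
  have "((\<lambda>\<rho>. vector_derivative P (at \<rho> within {a..b})) has_integral (P l - P a)) {a..l}"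
  proof (rule fundamental_theorem_of_calculus)
    fix x assume "x \<in> {a..l}"
    with l show "(P has_vector_derivative vector_derivative P (at x within {a..b})) (at x within {a..l})"
      unfolding has_real_derivative_iff_has_vector_derivative[symmetric]
      by (intro DERIV_subset[OF C1_on_has_derivative[OF assms(1)]]) auto
  qed (use l in auto)
  then have "P l - P a = integral {a..l} (\<lambda>\<rho>. vector_derivative P (at \<rho> within {a..b}))"
    by (simp add: has_integral_iff)
  also have "\<dots> = integral {a..l} (\<lambda>\<rho>. d\<Phi> \<rho> * D (clock_inv (clock \<rho>)))"
    using l deriv_\<Phi>_neq_0 by (intro integral_cong) (auto simp: D_def phi_deriv_def)
  also have "\<dots> = integral {0..clock l} (\<lambda>s. D (clock_inv s))"
    using l clock_range[OF l]
    by (intro integral_clock_substitution absolutely_integrable_continuous_real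
        continuous_on_subset[OF continuous_on_compose_clock_inv[OF D]]) auto
  finally show "P l = P a + frac_int 1 (\<lambda>s. D (clock_inv s)) (clock l)"
    by (simp add: frac_int_1)
qed

lemma C1_on_primitiveI:
  assumes "continuous_on {0..horizon} p"
    and P: "\<And>l. l \<in> {a..b} \<Longrightarrow> P l = frac_int 1 p (clock l)"
  shows "C1_on a b P" and "l \<in> {a..b} \<Longrightarrow> phi_deriv a b \<Phi> P l = p (clock l)"
proof -
  have deriv: "(P has_real_derivative p (clock l) * d\<Phi> l) (at l within {a..b})" if l: "l \<in> {a..b}" for l
  proof -
    have "(frac_int 1 p has_real_derivative p (clock l)) (at (clock l) within clock ` {a..b})"
      using frac_int_1_has_vector_derivative[OF assms(1) clock_range[OF l]] clock_image[of b] a_less_b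
      by (simp add: has_real_derivative_iff_has_vector_derivative)
    then have "((\<lambda>l. frac_int 1 p (clock l)) has_real_derivative p (clock l) * d\<Phi> l) (at l within {a..b})"
      using DERIV_image_chain[OF _ clock_has_derivative[OF l]] by (simp add: o_def)
    then show ?thesis
      unfolding has_real_derivative_iff_has_vector_derivative
      by (rule has_vector_derivative_transform[OF l, rotated]) (rule P)
  qed
  have cont: "continuous_on {a..b} (\<lambda>l. p (clock l) * d\<Phi> l)"
    using C1_\<Phi> unfolding C1_on_def by (intro continuous_intros continuous_on_compose_clock assms(1)) auto
  show "C1_on a b P"
    using C1_onI(1)[OF deriv cont] .
  show "phi_deriv a b \<Phi> P l = p (clock l)" if l: "l \<in> {a..b}"
    using C1_onI(2)[OF deriv cont l] deriv_\<Phi>_neq_0[OF l] by (simp add: phi_deriv_def)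
qed

section \<open>Caputo derivatives on the new time scale\<close>

lemma caputo_primitive_eq_frac_int:
  assumes "0 < \<alpha>" "\<alpha> \<le> 1" "continuous_on {a..b} z" "l \<in> {a..b}"
  shows "caputo_primitive a b \<Phi> \<alpha> z l = frac_int (1 - \<alpha>) (\<lambda>s. z (clock_inv s) - z a) (clock l)"
  using assms
  by (auto simp: caputo_primitive_def intro!: rl_integral_eq_frac_int continuous_intros)

text \<open>
  This lemma and the next characterise the extended derivative, read in the new time, as the continuous
  function whose primitive is the fractional integral of \<open>z - z(a)\<close>.  No derivative occurs in this
  description, so the equation can be treated by fractional integrals alone.
\<close>

lemma caputo_ext_primitive:
  assumes "0 < \<alpha>" "\<alpha> \<le> 1" "caputo_ext_dom a b \<Phi> \<alpha> z"
  defines "D \<equiv> \<lambda>s. caputo_ext a b \<Phi> \<alpha> z (clock_inv s)"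
  shows "continuous_on {0..horizon} D"
    and "t \<in> {0..horizon} \<Longrightarrow> frac_int (1 - \<alpha>) (\<lambda>s. z (clock_inv s) - z a) t = frac_int 1 D t"
proof -
  have z: "continuous_on {a..b} z" and C1: "C1_on a b (caputo_primitive a b \<Phi> \<alpha> z)"
    using assms(3) by (auto simp: caputo_ext_dom_def)
  show "continuous_on {0..horizon} D"
    unfolding D_def caputo_ext_def
    by (intro continuous_on_compose_clock_inv phi_deriv_fundamental C1)
  assume t: "t \<in> {0..horizon}"
  have "caputo_primitive a b \<Phi> \<alpha> z a = 0"
    using caputo_primitive_eq_frac_int[OF assms(1,2) z, of a] a_less_b assms(2)
    by (cases "\<alpha> = 1") (auto simp: frac_int_at_0)
  then show "frac_int (1 - \<alpha>) (\<lambda>s. z (clock_inv s) - z a) t = frac_int 1 D t"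
    using phi_deriv_fundamental(2)[OF C1 clock_inv_range[OF t]]
      caputo_primitive_eq_frac_int[OF assms(1,2) z clock_inv_range[OF t]] t
    by (simp add: D_def caputo_ext_def)
qed

lemma caputo_extI:
  assumes "0 < \<alpha>" "\<alpha> \<le> 1" "continuous_on {a..b} z" "continuous_on {0..horizon} p"
    and "\<And>t. t \<in> {0..horizon} \<Longrightarrow> frac_int (1 - \<alpha>) (\<lambda>s. z (clock_inv s) - z a) t = frac_int 1 p t"
  shows "caputo_ext_dom a b \<Phi> \<alpha> z" and "l \<in> {a..b} \<Longrightarrow> caputo_ext a b \<Phi> \<alpha> z l = p (clock l)"
proof -
  have eq: "caputo_primitive a b \<Phi> \<alpha> z l = frac_int 1 p (clock l)" if "l \<in> {a..b}" for l
    using caputo_primitive_eq_frac_int[OF assms(1-3) that] assms(5)[OF clock_range[OF that]] by simp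
  show "caputo_ext_dom a b \<Phi> \<alpha> z"
    using C1_on_primitiveI(1)[OF assms(4) eq] assms(3) by (simp add: caputo_ext_dom_def)
  show "l \<in> {a..b} \<Longrightarrow> caputo_ext a b \<Phi> \<alpha> z l = p (clock l)"
    using C1_on_primitiveI(2)[OF assms(4) eq] by (simp add: caputo_ext_def)
qed

lemma C1_on_imp_continuous_on: "C1_on a b z \<Longrightarrow> continuous_on {a..b} z"
  by (simp add: C1_on_def differentiable_imp_continuous_on)

lemma caputo_eq_frac_int:
  assumes "0 < \<alpha>" "\<alpha> \<le> 1" "C1_on a b z" "l \<in> {a..b}"
  shows "caputo a b \<Phi> \<alpha> z l = frac_int (1 - \<alpha>) (\<lambda>s. phi_deriv a b \<Phi> z (clock_inv s)) (clock l)"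
proof (cases "\<alpha> = 1")
  case True
  then show ?thesis using assms(4) by (simp add: caputo_def)
next
  case False
  with assms have "\<lfloor>\<alpha>\<rfloor> = 0" "\<alpha> \<notin> \<nat>"
    by (auto simp: floor_eq_iff elim!: Nats_cases)
  then have "caputo a b \<Phi> \<alpha> z l = rl_integral a b \<Phi> (1 - \<alpha>) (phi_deriv a b \<Phi> z) l"
    by (simp add: caputo_def)
  then show ?thesis
    using rl_integral_eq_frac_int[OF assms(4) _ phi_deriv_fundamental(1)[OF assms(3)]] assms False
    by simp
qed

text \<open>
  For \<open>C\<^sup>1\<close> functions the order of differentiation and fractional integration is immaterial: \<open>z - z(a)\<close>
  is the primitive of the \<open>\<Phi>\<close>-derivative of \<open>z\<close>, and fractional integrals commute.
\<close>

lemma caputo_ext_C1: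
  assumes "0 < \<alpha>" "\<alpha> \<le> 1" "C1_on a b z"
  shows "caputo_ext_dom a b \<Phi> \<alpha> z"
    and "l \<in> {a..b} \<Longrightarrow> caputo_ext a b \<Phi> \<alpha> z l = caputo a b \<Phi> \<alpha> z l"
proof -
  define D where "D s = phi_deriv a b \<Phi> z (clock_inv s)" for s
  have D: "continuous_on {0..horizon} D"
    unfolding D_def by (intro continuous_on_compose_clock_inv phi_deriv_fundamental assms)
  have "frac_int (1 - \<alpha>) (\<lambda>s. z (clock_inv s) - z a) t = frac_int 1 (frac_int (1 - \<alpha>) D) t"
    if t: "t \<in> {0..horizon}" for t
  proof -
    have "frac_int (1 - \<alpha>) (\<lambda>s. z (clock_inv s) - z a) t = frac_int (1 - \<alpha>) (frac_int 1 D) t"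
    proof (rule frac_int_cong)
      fix s assume "s \<in> {0..t}"
      with t have "s \<in> {0..horizon}" by auto
      then show "z (clock_inv s) - z a = frac_int 1 D s"
        using phi_deriv_fundamental(2)[OF assms(3) clock_inv_range] by (simp add: D_def[abs_def])
    qed (use t in auto)
    then show ?thesis
      using t D horizon_pos assms by (simp add: frac_int_semigroup[where T = horizon] add.commute)
  qed
  moreover have "continuous_on {0..horizon} (frac_int (1 - \<alpha>) D)"
    using D horizon_pos assms by (intro continuous_on_frac_int) auto
  ultimately show "caputo_ext_dom a b \<Phi> \<alpha> z"
    and "l \<in> {a..b} \<Longrightarrow> caputo_ext a b \<Phi> \<alpha> z l = caputo a b \<Phi> \<alpha> z l"
    using caputo_extI[OF assms(1,2) C1_on_imp_continuous_on[OF assms(3)]]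
      caputo_eq_frac_int[OF assms] by (auto simp: D_def[abs_def])
qed

section \<open>Solutions of the initial value problem\<close>

lemma C1_solution_iff_ext_solution:
  assumes "0 < \<kappa>" "\<kappa> < \<mu>" "\<mu> \<le> 1"
  shows "C1_solution a b \<Phi> \<mu> \<kappa> \<omega> H za z \<longleftrightarrow> C1_on a b z \<and> ext_solution a b \<Phi> \<mu> \<kappa> \<omega> H za z"
  using caputo_ext_C1[of \<mu> z] caputo_ext_C1[of \<kappa> z] assms
  unfolding C1_solution_def ext_solution_def by auto

lemma solution_formula_eq_frac_int:
  assumes "0 < \<kappa>" "\<kappa> < \<mu>" "\<mu> \<le> 1" "continuous_on {a..b} H" "l \<in> {a..b}"
  shows "solution_formula a b \<Phi> \<mu> \<kappa> \<omega> H za l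
    = za + frac_int \<mu> (neumann_series \<omega> (\<mu> - \<kappa>) (\<lambda>s. H (clock_inv s))) (clock l)"
proof (cases "l = a")
  case True
  then show ?thesis using assms by (simp add: solution_formula_def frac_int_at_0)
next
  case False
  then have t: "0 < clock l" using clock_less[of a l] assms(5) by simp
  define E where "E s = mittag_leffler (\<mu> - \<kappa>) \<mu> (- \<omega> * (clock l - s) powr (\<mu> - \<kappa>))" for s
  have H: "continuous_on {0..clock l} (\<lambda>s. H (clock_inv s))"
    using clock_range[OF assms(5)]
    by (intro continuous_on_subset[OF continuous_on_compose_clock_inv[OF assms(4)]]) auto
  note ml = frac_int_mittag_leffler[OF t _ _ _ H, of "\<mu> - \<kappa>" \<mu> \<omega>, folded E_def]
  have "integral {a..l} (\<lambda>\<rho>. d\<Phi> \<rho> * (\<Phi> l - \<Phi> \<rho>) powr (\<mu> - 1) *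
       mittag_leffler (\<mu> - \<kappa>) \<mu> (- \<omega> * (\<Phi> l - \<Phi> \<rho>) powr (\<mu> - \<kappa>)) * H \<rho>)
    = integral {a..l} (\<lambda>\<rho>. d\<Phi> \<rho> * (\<Phi> l - \<Phi> \<rho>) powr (\<mu> - 1) / Gamma \<mu> *
        (Gamma \<mu> * E (clock \<rho>) * H (clock_inv (clock \<rho>))))"
  proof (rule integral_cong)
    fix \<rho> assume "\<rho> \<in> {a..l}"
    moreover have "Gamma \<mu> > 0" using assms by simp
    ultimately show "d\<Phi> \<rho> * (\<Phi> l - \<Phi> \<rho>) powr (\<mu> - 1) *
       mittag_leffler (\<mu> - \<kappa>) \<mu> (- \<omega> * (\<Phi> l - \<Phi> \<rho>) powr (\<mu> - \<kappa>)) * H \<rho>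
      = d\<Phi> \<rho> * (\<Phi> l - \<Phi> \<rho>) powr (\<mu> - 1) / Gamma \<mu> *
        (Gamma \<mu> * E (clock \<rho>) * H (clock_inv (clock \<rho>)))"
      using assms(5) by (simp add: E_def) (simp add: clock_def)
  qed
  also have "\<dots> = frac_int \<mu> (\<lambda>s. Gamma \<mu> * E s * H (clock_inv s)) (clock l)"
    using ml assms by (intro integral_kernel_clock) auto
  also have "\<dots> = frac_int \<mu> (neumann_series \<omega> (\<mu> - \<kappa>) (\<lambda>s. H (clock_inv s))) (clock l)"
    using ml assms by simp
  finally show ?thesis by (simp add: solution_formula_def)
qed

lemma ext_solution_iff:
  assumes "0 < \<kappa>" "\<kappa> < \<mu>" "\<mu> \<le> 1" "continuous_on {a..b} H"
  shows "ext_solution a b \<Phi> \<mu> \<kappa> \<omega> H za z \<longleftrightarrow>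
    (\<forall>l\<in>{a..b}. z l = solution_formula a b \<Phi> \<mu> \<kappa> \<omega> H za l)"
proof -
  define h where "h s = H (clock_inv s)" for s
  define g where "g = neumann_series \<omega> (\<mu> - \<kappa>) h"
  have h: "continuous_on {0..horizon} h"
    unfolding h_def by (intro continuous_on_compose_clock_inv assms)
  have g: "continuous_on {0..horizon} g"
    unfolding g_def using horizon_pos assms h by (intro continuous_on_neumann_series) auto
  have formula: "solution_formula a b \<Phi> \<mu> \<kappa> \<omega> H za l = za + frac_int \<mu> g (clock l)"
    if "l \<in> {a..b}" for l
    using solution_formula_eq_frac_int[OF assms that] by (simp add: g_def h_def[abs_def])
  show ?thesis
  proof
    assume sol: "ext_solution a b \<Phi> \<mu> \<kappa> \<omega> H za z"
    then have dom: "caputo_ext_dom a b \<Phi> \<mu> z" "caputo_ext_dom a b \<Phi> \<kappa> z" and z: "z a = za"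
      and eq: "\<And>l. l \<in> {a..b} \<Longrightarrow> caputo_ext a b \<Phi> \<mu> z l + \<omega> * caputo_ext a b \<Phi> \<kappa> z l = H l"
      by (auto simp: ext_solution_def)
    have "continuous_on {0..horizon} (\<lambda>s. z (clock_inv s) - z a)"
      using dom(1) by (intro continuous_intros continuous_on_compose_clock_inv) (simp add: caputo_ext_dom_def)
    then have "z (clock_inv t) - z a = frac_int \<mu> g t" if "t \<in> {0..horizon}" for t
      unfolding g_def using that assms horizon_pos h
        caputo_ext_primitive[OF _ _ dom(1)] caputo_ext_primitive[OF _ _ dom(2)]
        eq[OF clock_inv_range]
      by (intro frac_equation_unique[where p = "\<lambda>s. caputo_ext a b \<Phi> \<mu> z (clock_inv s)"
            and q = "\<lambda>s. caputo_ext a b \<Phi> \<kappa> z (clock_inv s)" and T = horizon])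
         (auto simp: h_def)
    from this[OF clock_range] show "\<forall>l\<in>{a..b}. z l = solution_formula a b \<Phi> \<mu> \<kappa> \<omega> H za l"
      using z by (auto simp: formula algebra_simps)
  next
    assume sol: "\<forall>l\<in>{a..b}. z l = solution_formula a b \<Phi> \<mu> \<kappa> \<omega> H za l"
    have zf: "z l = za + frac_int \<mu> g (clock l)" if "l \<in> {a..b}" for l
      using sol formula that by simp
    have za: "z a = za"
      using zf[of a] a_less_b assms by (simp add: frac_int_at_0)
    have z: "continuous_on {a..b} z"
    proof (rule continuous_on_eq)
      show "continuous_on {a..b} (\<lambda>l. za + frac_int \<mu> g (clock l))"
        using assms g horizon_pos
        by (intro continuous_intros continuous_on_compose_clock continuous_on_frac_int) auto
    qed (simp add: zf)
    have shift: "frac_int \<alpha> (\<lambda>s. z (clock_inv s) - z a) t = frac_int \<alpha> (frac_int \<mu> g) t"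
      if "t \<in> {0..horizon}" for \<alpha> t
    proof (rule frac_int_cong)
      fix s assume "s \<in> {0..t}"
      with that have "s \<in> {0..horizon}" by auto
      then show "z (clock_inv s) - z a = frac_int \<mu> g s"
        using zf[OF clock_inv_range] za by simp
    qed (use that in auto)
    note std = frac_equation_solution[OF horizon_pos assms(1-3) h, where \<omega> = \<omega>, folded g_def]
    have q: "continuous_on {0..horizon} (frac_int (\<mu> - \<kappa>) g)"
      using assms g horizon_pos by (intro continuous_on_frac_int) auto
    have \<mu>: "caputo_ext_dom a b \<Phi> \<mu> z" "\<And>l. l \<in> {a..b} \<Longrightarrow> caputo_ext a b \<Phi> \<mu> z l = g (clock l)"
      using caputo_extI[OF _ _ z g, of \<mu>] assms shift std(1) by auto
    have \<kappa>: "caputo_ext_dom a b \<Phi> \<kappa> z"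
      "\<And>l. l \<in> {a..b} \<Longrightarrow> caputo_ext a b \<Phi> \<kappa> z l = frac_int (\<mu> - \<kappa>) g (clock l)"
      using caputo_extI[OF _ _ z q, of \<kappa>] assms shift std(2) by auto
    show "ext_solution a b \<Phi> \<mu> \<kappa> \<omega> H za z"
      unfolding ext_solution_def
      using \<mu> \<kappa> za std(3)[OF clock_range] by (auto simp: h_def)
  qed
qed

end

theorem lemma5:
  fixes a b \<kappa> \<mu> \<omega> za :: real and \<Phi> H :: "real \<Rightarrow> real"
  assumes "0 \<le> a" and "a < b"
    and "C1_on a b \<Phi>" and "mono_on {a..b} \<Phi>"
    and "\<forall>l\<in>{a..b}. vector_derivative \<Phi> (at l within {a..b}) \<noteq> 0"
    and "continuous_on {a..b} H"
    and "0 < \<kappa>" and "\<kappa> < \<mu>" and "\<mu> \<le> 1" and "0 < \<omega>"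
  shows "ext_solution a b \<Phi> \<mu> \<kappa> \<omega> H za (solution_formula a b \<Phi> \<mu> \<kappa> \<omega> H za) \<and>
    (\<forall>z. ext_solution a b \<Phi> \<mu> \<kappa> \<omega> H za z \<longrightarrow>
       (\<forall>l\<in>{a..b}. z l = solution_formula a b \<Phi> \<mu> \<kappa> \<omega> H za l)) \<and>
    (\<forall>z. C1_solution a b \<Phi> \<mu> \<kappa> \<omega> H za z \<longleftrightarrow>
       C1_on a b z \<and> (\<forall>l\<in>{a..b}. z l = solution_formula a b \<Phi> \<mu> \<kappa> \<omega> H za l))"
proof -
  interpret time_change a b \<Phi>
    using assms by unfold_locales auto
  show ?thesis
    using assms by (simp add: ext_solution_iff C1_solution_iff_ext_solution)
qed

end
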